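(* Let $S=\{1,\dots,s\}$, and for each $n\ge0$ and $i\in S$ let $D_i(n)\subset S\setminus\{i\}$ be given sets such that $j\in D_i(n)$ if and only if $i\in D_j(n)$. Put $d_i(n)=|D_i(n)|$ and consider the JLM model $$\theta_i(n+1)=\frac{1}{1+d_i(n)}\Big[\theta_i(n)+\sum_{j\in D_i(n)}\theta_j(n)\Big],\qquad i\in S,\ n\ge 0,$$ with transition chain $(A_n)$. The following are equivalent: 1. $(A_n)$ is ergodic (equivalently, unconditional consensus occurs: for every initial time $k$ and all initial values $\theta_i(k)\in\mathbb{R}$, all $\theta_i(n)$ converge to a common limit as $n\to\infty$); 2. $(A_n)$ has the infinite flow property; 3. the strong interaction graph of $(A_n)$ is connected; 4. there exists an infinite sequence of contiguous, nonempty (not necessarily bounded in length) time intervals $[n_i,n_{i+1})$, $i\ge0$, such that across each such interval the $s$ agents are linked together.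
   Context: The transition chain is the sequence of row stochastic matrices $A_n=(a_{ij}(n))$ with $a_{ij}(n)=\frac{1}{1+d_i(n)}$ if $j=i$ or $j\in D_i(n)$, and $a_{ij}(n)=0$ otherwise. The neighbor sets $D_i(n)$ are pre-defined (they do not depend on the states). For $n>k\ge 0$ let $A(n,k)=A_{n-1}A_{n-2}\cdots A_k$. The chain $(A_n)$ is ergodic if for each $k\ge0$ the limit $\lim_{n\to\infty}A(n,k)$ exists and is equal to a matrix with identical rows. The chain has the infinite flow property if for every $T\subset S$ with $T\neq\emptyset$, $T\ne S$, one has $\sum_{n=0}^\infty\sum_{i\in T,\,j\notin T}(a_{ij}(n)+a_{ji}(n))=\infty$. The strong interaction graph has node set $S$, with an edge from $i$ to $j$ if and only if $\sum_{n=0}^\infty a_{ij}(n)=\infty$; in the JLM model there is an edge from $i$ to $j$ if and only if there is one from $j$ to $i$, so it is regarded as an undirected graph. The agents are linked together across $[n_i,n_{i+1})$, where $n_i<n_{i+1}$ are nonnegative integers, if the undirected graph on $S$ whose edges are the pairs $\{p,q\}$ with $q\in D_p(n)$ for some $n\in[n_i,n_{i+1})$ is connected. *)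

theory Defs
  imports "Graph_Theory.Digraph_Component" "HOL-Analysis.Analysis"
begin

text \<open>
  The agent set \<open>S = {1,...,s}\<close> is rendered as an arbitrary finite type \<open>'s\<close>
  (so \<open>s = CARD('s)\<close>, \<open>s \<ge> 1\<close>). The neighbor set \<open>D\<^sub>i(n)\<close> is written \<open>D n i\<close>, and
  a chain of matrices is a function \<open>A\<close> with \<open>a\<^sub>i\<^sub>j(n) = A n $ i $ j\<close>.
\<close>

definition jlm_chain :: "(nat \<Rightarrow> 's::finite \<Rightarrow> 's set) \<Rightarrow> nat \<Rightarrow> real^'s^'s" where
  "jlm_chain D n =
     (\<chi> i j. if j = i \<or> j \<in> D n i then 1 / (1 + real (card (D n i))) else 0)"

definition jlm_evolution ::
    "(nat \<Rightarrow> 's::finite \<Rightarrow> 's set) \<Rightarrow> nat \<Rightarrow> (nat \<Rightarrow> 's \<Rightarrow> real) \<Rightarrow> bool" where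
  "jlm_evolution D k \<theta> \<longleftrightarrow>
     (\<forall>n\<ge>k. \<forall>i. \<theta> (n + 1) i =
        1 / (1 + real (card (D n i))) * (\<theta> n i + (\<Sum>j\<in>D n i. \<theta> n j)))"

text \<open>
  The values of \<open>\<theta>\<close> before time \<open>k\<close> are irrelevant, and those at time \<open>k\<close> are
  unconstrained, so quantifying over all \<open>\<theta>\<close> quantifies over all initial values.
\<close>

definition unconditional_consensus :: "(nat \<Rightarrow> 's::finite \<Rightarrow> 's set) \<Rightarrow> bool" where
  "unconditional_consensus D \<longleftrightarrow>
     (\<forall>k \<theta>. jlm_evolution D k \<theta> \<longrightarrow> (\<exists>c. \<forall>i. (\<lambda>n. \<theta> n i) \<longlonglongrightarrow> c))"

text \<open>
  For \<open>n > k\<close>, \<open>backward_product A n k\<close> is \<open>A\<^sub>n\<^sub>-\<^sub>1 A\<^sub>n\<^sub>-\<^sub>2 \<cdots> A\<^sub>k\<close>; for \<open>n \<le> k\<close> it is the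
  identity, which does not affect limits as \<open>n \<rightarrow> \<infinity>\<close>.
\<close>

primrec backward_product ::
    "(nat \<Rightarrow> real^'s^'s) \<Rightarrow> nat \<Rightarrow> nat \<Rightarrow> real^('s::finite)^'s" where
  "backward_product A 0 k = mat 1"
| "backward_product A (Suc n) k = (if k \<le> n then A n ** backward_product A n k else mat 1)"

definition ergodic :: "(nat \<Rightarrow> real^'s^'s::finite) \<Rightarrow> bool" where
  "ergodic A \<longleftrightarrow>
     (\<forall>k. \<exists>L. (\<lambda>n. backward_product A n k) \<longlonglongrightarrow> L \<and> (\<forall>i j. row i L = row j L))"

text \<open>
  The next two notions are meant for chains with nonnegative entries (such as
  stochastic ones), for which passing to \<open>ennreal\<close> loses nothing.
\<close>

definition infinite_flow :: "(nat \<Rightarrow> real^'s^'s::finite) \<Rightarrow> bool" where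
  "infinite_flow A \<longleftrightarrow>
     (\<forall>T. T \<noteq> {} \<and> T \<noteq> UNIV \<longrightarrow>
        (\<Sum>n. ennreal (\<Sum>i\<in>T. \<Sum>j\<in>- T. A n $ i $ j + A n $ j $ i)) = \<infinity>)"

definition strong_interaction_graph ::
    "(nat \<Rightarrow> real^'s^'s::finite) \<Rightarrow> 's pair_pre_digraph" where
  "strong_interaction_graph A =
     \<lparr> pverts = UNIV, parcs = {(i, j). (\<Sum>n. ennreal (A n $ i $ j)) = \<infinity>} \<rparr>"

definition interaction_graph ::
    "(nat \<Rightarrow> 's::finite \<Rightarrow> 's set) \<Rightarrow> nat \<Rightarrow> nat \<Rightarrow> 's pair_pre_digraph" where
  "interaction_graph D a b =
     \<lparr> pverts = UNIV, parcs = {(p, q). \<exists>n\<in>{a..<b}. q \<in> D n p} \<rparr>"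

text \<open>
  \<open>Digraph_Component.connected\<close> (not to be confused with topological connectedness) is
  connectedness of the underlying undirected graph; self-loops are immaterial to it.
\<close>

definition linked_together :: "(nat \<Rightarrow> 's::finite \<Rightarrow> 's set) \<Rightarrow> nat \<Rightarrow> nat \<Rightarrow> bool" where
  "linked_together D a b \<longleftrightarrow> Digraph_Component.connected (interaction_graph D a b)"

end

theory Submission
  imports Defs
begin

text \<open>
  All four conditions say that every cut \<open>T\<close> is crossed at infinitely many times. If a cut is
  crossed only finitely often, its indicator function is eventually a stationary solution.
  Otherwise let a set \<open>C\<close> grow from a single agent, absorbing the neighbors of \<open>C\<close> whenever
  \<open>C\<close> is crossed. By symmetry of the neighbor relation, an uncrossed \<open>C\<close> evolves
  autonomously, so its minimal value does not decrease; each absorption costs at most a factor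
  \<open>1/s\<close> in the height above the global minimum. There are fewer than \<open>s\<close> absorptions, however
  long the waiting times are, so starting from a maximal agent the diameter of the states
  contracts by \<open>1 - (1/s)\<^sup>s\<close> again and again.
\<close>

section \<open>Cuts of graphs, divergent series and contracting sequences\<close>

text \<open>A path from inside \<open>T\<close> to outside must use an arc across the boundary. This
  allows both connectivity conditions to be treated cut by cut.\<close>

lemma connected_iff_crossing:
  assumes "pverts G = (UNIV :: 'a set)"
  shows "Digraph_Component.connected (with_proj G) \<longleftrightarrow>
    (\<forall>T. T \<noteq> {} \<and> T \<noteq> UNIV \<longrightarrow> (\<exists>p\<in>T. \<exists>q\<in>-T. (p, q) \<in> parcs G \<or> (q, p) \<in> parcs G))"
    (is "?L \<longleftrightarrow> ?R")
proof -
  let ?E = "parcs (mk_symmetric (with_proj G))"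
  have E: "(p, q) \<in> ?E \<longleftrightarrow> (p, q) \<in> parcs G \<or> (q, p) \<in> parcs G" for p q
    by (auto simp: parcs_mk_symmetric Bex_def)
  have conn: "?L \<longleftrightarrow> (\<forall>u v. (u, v) \<in> rtrancl_on UNIV ?E)"
    using assms by (simp add: connected_def strongly_connected_def reachable_def)
  show ?thesis
  proof
    assume ?L
    show ?R
    proof (intro allI impI, rule ccontr)
      fix T :: "'a set"
      assume T: "T \<noteq> {} \<and> T \<noteq> UNIV"
        and no: "\<not> (\<exists>p\<in>T. \<exists>q\<in>-T. (p, q) \<in> parcs G \<or> (q, p) \<in> parcs G)"
      from T obtain u v where uv: "u \<in> T" "v \<notin> T" by blast
      have "(u, v) \<in> rtrancl_on UNIV ?E" using \<open>?L\<close> conn by blast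
      then have "v \<in> T"
        by (induction rule: rtrancl_on_induct) (use uv(1) in simp, use no E in blast)
      with uv show False by simp
    qed
  next
    assume R: ?R
    have "(u, v) \<in> rtrancl_on UNIV ?E" for u v
    proof -
      \<comment> \<open>The set reachable from \<open>u\<close> is closed under arcs in both
        directions; were it a proper subset, it would be a nonempty uncrossed cut.\<close>
      let ?T = "{w. (u, w) \<in> rtrancl_on UNIV ?E}"
      have "q \<in> ?T" if "p \<in> ?T" "(p, q) \<in> parcs G \<or> (q, p) \<in> parcs G" for p q
        using that E rtrancl_on_into_rtrancl_on[of u p UNIV ?E q] by auto
      then have "\<not> (\<exists>p\<in>?T. \<exists>q\<in>-?T. (p, q) \<in> parcs G \<or> (q, p) \<in> parcs G)"
        by (meson ComplD)
      moreover have "?T \<noteq> {}" using rtrancl_on_refl[of u UNIV ?E] by fast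
      ultimately have "?T = UNIV" using R[rule_format, of ?T] by (metis (no_types))
      then show ?thesis by blast
    qed
    then show ?L using conn by blast
  qed
qed

text \<open>Summability drives the terms below the gap \<open>c\<close>, where only the value 0 is
  left.\<close>

lemma suminf_ennreal_infinite_iff_frequently:
  fixes f :: "nat \<Rightarrow> real"
  assumes "c > 0" and f: "\<And>n. f n = 0 \<or> f n \<ge> c"
  shows "(\<Sum>n. ennreal (f n)) = \<infinity> \<longleftrightarrow> (\<exists>\<^sub>F n in sequentially. f n \<noteq> 0)"
proof -
  have nonneg: "f n \<ge> 0" for n using f[of n] \<open>c > 0\<close> by auto
  have "(\<Sum>n. ennreal (f n)) \<noteq> \<infinity> \<longleftrightarrow> summable f"
    unfolding infinity_ennreal_def
    by (metis summable_suminf_not_top[of f] ennreal_suminf_neq_top[of f] nonneg)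
  also have "\<dots> \<longleftrightarrow> (\<forall>\<^sub>F n in sequentially. f n = 0)"
  proof
    assume "summable f"
    then have "\<forall>\<^sub>F n in sequentially. f n < c"
      using summable_LIMSEQ_zero order_tendstoD(2) \<open>c > 0\<close> by blast
    then show "\<forall>\<^sub>F n in sequentially. f n = 0"
      by eventually_elim (metis f leD)
  next
    assume "\<forall>\<^sub>F n in sequentially. f n = 0"
    then show "summable f"
      using summable_cong[of f "\<lambda>_. 0"] by simp
  qed
  finally show ?thesis by (auto simp: frequently_def)
qed

text \<open>The limit \<open>L\<close> lies below every value, so the contraction passes to
  \<open>L \<le> (1 - \<epsilon>) * L\<close>. Here \<open>N\<close> may depend on \<open>n\<close>
  arbitrarily, to accommodate unbounded waiting times between crossings.\<close>

lemma decseq_contracting_tendsto_zero: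
  fixes g :: "nat \<Rightarrow> real"
  assumes "decseq g" and "\<And>n. g n \<ge> 0" and "\<epsilon> > 0"
    and contract: "\<And>n. \<exists>N. g N \<le> (1 - \<epsilon>) * g n"
  shows "g \<longlonglongrightarrow> 0"
proof -
  obtain L where L: "g \<longlonglongrightarrow> L" "\<And>n. L \<le> g n"
    using decseq_convergent[OF \<open>decseq g\<close>, of 0] assms(2) by blast
  have "L \<ge> 0" using L(1) assms(2) by (simp add: LIMSEQ_le_const)
  have "L \<le> (1 - \<epsilon>) * g n" for n
    using contract[of n] L(2) order_trans by blast
  moreover have "(\<lambda>n. (1 - \<epsilon>) * g n) \<longlonglongrightarrow> (1 - \<epsilon>) * L"
    using L(1) by (intro tendsto_intros)
  ultimately have "L \<le> (1 - \<epsilon>) * L" by (simp add: LIMSEQ_le_const)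
  then have "\<epsilon> * L \<le> 0" by (simp add: algebra_simps)
  then have "L = 0" using \<open>\<epsilon> > 0\<close> \<open>L \<ge> 0\<close> by (simp add: mult_le_0_iff)
  with L show ?thesis by simp
qed

section \<open>Backward products and solutions\<close>

lemma backward_product_self [simp]: "backward_product A k k = mat 1"
  by (cases k) auto

locale jlm =
  fixes D :: "nat \<Rightarrow> 's::finite \<Rightarrow> 's set"
  assumes D_irrefl: "\<And>n i. D n i \<subseteq> UNIV - {i}"
    and D_sym: "\<And>n i j. j \<in> D n i \<longleftrightarrow> i \<in> D n j"
begin

lemma not_neighbor_self [simp]: "i \<notin> D n i"
  using D_irrefl by blast

text \<open>One step takes arithmetic means over closed neighborhoods
  \<open>insert i (D n i)\<close>; the contraction estimates use this form.\<close>

lemma jlm_chain_mult_vec: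
  "(jlm_chain D n *v x) $ i = (\<Sum>j\<in>insert i (D n i). x $ j) / real (card (insert i (D n i)))"
proof -
  have "(jlm_chain D n *v x) $ i =
      (\<Sum>j\<in>UNIV. if j \<in> insert i (D n i) then x $ j / real (card (insert i (D n i))) else 0)"
    unfolding matrix_vector_mult_def jlm_chain_def
    by (auto intro!: sum.cong)
  also have "\<dots> = (\<Sum>j\<in>insert i (D n i). x $ j / real (card (insert i (D n i))))"
    by (rule sum.mono_neutral_cong_right) auto
  finally show ?thesis by (simp only: sum_divide_distrib)
qed

lemma jlm_evolution_iff_average:
  "jlm_evolution D k \<theta> \<longleftrightarrow>
    (\<forall>n\<ge>k. \<forall>i. \<theta> (Suc n) i =
       (\<Sum>j\<in>insert i (D n i). \<theta> n j) / real (card (insert i (D n i))))"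
  by (simp add: jlm_evolution_def)

lemma jlm_evolution_average:
  assumes "jlm_evolution D k \<theta>" "k \<le> n"
  shows "\<theta> (Suc n) i = (\<Sum>j\<in>insert i (D n i). \<theta> n j) / real (card (insert i (D n i)))"
  using assms unfolding jlm_evolution_iff_average by blast

lemma jlm_evolution_eq_backward_product:
  assumes "jlm_evolution D k \<theta>" "k \<le> n"
  shows "\<theta> n i = (backward_product (jlm_chain D) n k *v (\<chi> i. \<theta> k i)) $ i"
  using \<open>k \<le> n\<close>
proof (induction n arbitrary: i rule: dec_induct)
  case base
  show ?case by simp
next
  case (step n)
  then show ?case
    using assms(1)
    by (simp add: jlm_evolution_iff_average jlm_chain_mult_vec
        flip: matrix_vector_mul_assoc del: sum.insert card_insert_disjoint)
qed

text \<open>Supplies a solution for every starting vector; unit vectors then isolate the columns of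
  the product.\<close>

lemma jlm_evolution_backward_product:
  "jlm_evolution D k (\<lambda>n i. (backward_product (jlm_chain D) n k *v x) $ i)"
  by (simp add: jlm_evolution_iff_average jlm_chain_mult_vec
        flip: matrix_vector_mul_assoc del: sum.insert card_insert_disjoint)

lemma unconditional_consensusD:
  assumes "unconditional_consensus D" "jlm_evolution D k \<theta>"
  shows "\<exists>c. \<forall>i. (\<lambda>n. \<theta> n i) \<longlonglongrightarrow> c"
  using assms unfolding unconditional_consensus_def by iprover

lemma ergodic_iff_unconditional_consensus:
  "ergodic (jlm_chain D) \<longleftrightarrow> unconditional_consensus D"
proof
  assume erg: "ergodic (jlm_chain D)"
  show "unconditional_consensus D"
    unfolding unconditional_consensus_def
  proof (intro allI impI)
    fix k \<theta> assume evo: "jlm_evolution D k \<theta>"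
    define x where "x = (\<chi> i. \<theta> k i)"
    obtain L where L: "(\<lambda>n. backward_product (jlm_chain D) n k) \<longlonglongrightarrow> L"
      and rows: "\<And>i j. row i L = row j L"
      using erg[unfolded ergodic_def, rule_format, of k] by blast
    \<comment> \<open>All rows of \<open>L\<close> agree, so the entry at the arbitrary index
      \<open>undefined\<close> is the common limit.\<close>
    define c where "c = (L *v x) $ undefined"
    have c: "(L *v x) $ i = c" for i
    proof -
      have "L $ i = L $ undefined" using rows[of i undefined] by (simp add: row_def)
      then show ?thesis by (simp add: c_def matrix_vector_mult_def)
    qed
    have "(\<lambda>n. \<theta> n i) \<longlonglongrightarrow> c" for i
    proof (rule Lim_transform_eventually)
      have "(\<lambda>n. \<Sum>j\<in>UNIV. backward_product (jlm_chain D) n k $ i $ j * x $ j)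
          \<longlonglongrightarrow> (\<Sum>j\<in>UNIV. L $ i $ j * x $ j)"
        by (intro tendsto_sum tendsto_mult tendsto_vec_nth L tendsto_const)
      then show "(\<lambda>n. (backward_product (jlm_chain D) n k *v x) $ i) \<longlonglongrightarrow> c"
        unfolding c[of i, symmetric] by (simp add: matrix_vector_mult_def)
      show "\<forall>\<^sub>F n in sequentially. (backward_product (jlm_chain D) n k *v x) $ i = \<theta> n i"
        using eventually_ge_at_top[of k] unfolding x_def
        by eventually_elim (rule jlm_evolution_eq_backward_product[OF evo, symmetric])
    qed
    then show "\<exists>c. \<forall>i. (\<lambda>n. \<theta> n i) \<longlonglongrightarrow> c" by iprover
  qed
next
  assume cons: "unconditional_consensus D"
  show "ergodic (jlm_chain D)"
    unfolding ergodic_def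
  proof
    fix k
    let ?B = "\<lambda>n. backward_product (jlm_chain D) n k"
    have "\<exists>c. \<forall>i. (\<lambda>n. ?B n $ i $ j) \<longlonglongrightarrow> c" for j
    proof -
      \<comment> \<open>The solution started from the unit vector \<open>axis j 1\<close> is column
        \<open>j\<close> of the product. Its consensus value depends on \<open>j\<close> only, which
        makes the rows of the limit identical.\<close>
      have "\<exists>c. \<forall>i. (\<lambda>n. (?B n *v axis j 1) $ i) \<longlonglongrightarrow> c"
        by (rule unconditional_consensusD[OF cons jlm_evolution_backward_product])
      then show ?thesis by (simp only: matrix_vector_mult_basis column_def vec_lambda_beta)
    qed
    then obtain c where c: "\<And>i j. (\<lambda>n. ?B n $ i $ j) \<longlonglongrightarrow> c j"
      using choice[of "\<lambda>j c. \<forall>i. (\<lambda>n. ?B n $ i $ j) \<longlonglongrightarrow> c"] by blast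
    have "?B \<longlonglongrightarrow> (\<chi> i j. c j)"
      by (intro vec_tendstoI) (simp add: c)
    then show "\<exists>L. ?B \<longlonglongrightarrow> L \<and> (\<forall>i j. row i L = row j L)"
      by (intro exI[of _ "\<chi> i j. c j"]) (simp add: row_def)
  qed
qed

section \<open>Recurrent crossing of cuts\<close>

text \<open>One direction suffices, since the neighbor relation is symmetric.\<close>

definition crosses :: "nat \<Rightarrow> 's set \<Rightarrow> bool" where
  "crosses n T \<longleftrightarrow> (\<exists>p\<in>T. \<exists>q\<in>-T. q \<in> D n p)"

definition recurrent_cuts :: bool where
  "recurrent_cuts \<longleftrightarrow>
     (\<forall>T. T \<noteq> {} \<and> T \<noteq> UNIV \<longrightarrow> (\<exists>\<^sub>F n in sequentially. crosses n T))"

section \<open>Weights of the chain and flow across cuts\<close>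

lemma jlm_chain_nonneg: "jlm_chain D n $ i $ j \<ge> 0"
  by (simp add: jlm_chain_def)

lemma jlm_chain_eq_0_iff: "jlm_chain D n $ i $ j = 0 \<longleftrightarrow> j \<noteq> i \<and> j \<notin> D n i"
  by (simp add: jlm_chain_def add_nonneg_eq_0_iff)

lemma inverse_card_le:
  "1 / real CARD('s) \<le> 1 / real (card (insert i (D n i)))"
proof -
  have "card (insert i (D n i)) \<le> CARD('s)" by (rule card_mono) auto
  moreover have "card (insert i (D n i)) > 0" by (simp add: card_gt_0_iff)
  ultimately show ?thesis by (intro divide_left_mono) (auto simp del: card_insert_disjoint)
qed

text \<open>Closed neighborhoods have at most \<open>CARD('s)\<close> members, so nonzero weights
  stay away from 0 uniformly in time. This is the gap \<open>c\<close> of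
  \<open>suminf_ennreal_infinite_iff_frequently\<close>.\<close>

lemma jlm_chain_ge:
  assumes "jlm_chain D n $ i $ j \<noteq> 0"
  shows "jlm_chain D n $ i $ j \<ge> 1 / real CARD('s)"
  using assms inverse_card_le[of i n] by (auto simp: jlm_chain_def split: if_splits)

text \<open>The flow across \<open>T\<close> at one time is 0 without a crossing, and with one it is
  at least the weight of a single crossing arc.\<close>

lemma infinite_flow_iff_recurrent_cuts: "infinite_flow (jlm_chain D) \<longleftrightarrow> recurrent_cuts"
proof -
  let ?a = "\<lambda>n i j. jlm_chain D n $ i $ j"
  have "(\<Sum>n. ennreal (\<Sum>i\<in>T. \<Sum>j\<in>-T. ?a n i j + ?a n j i)) = \<infinity>
      \<longleftrightarrow> (\<exists>\<^sub>F n in sequentially. crosses n T)" for T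
  proof -
    let ?f = "\<lambda>n. \<Sum>i\<in>T. \<Sum>j\<in>-T. ?a n i j + ?a n j i"
    have nz: "?f n \<noteq> 0 \<longleftrightarrow> crosses n T" for n
    proof -
      have "?f n = 0 \<longleftrightarrow> (\<forall>i\<in>T. \<forall>j\<in>-T. ?a n i j = 0 \<and> ?a n j i = 0)"
        by (simp add: sum_nonneg_eq_0_iff sum_nonneg add_nonneg_eq_0_iff jlm_chain_nonneg)
      also have "\<dots> \<longleftrightarrow> \<not> crosses n T"
        unfolding jlm_chain_eq_0_iff crosses_def using D_sym by blast
      finally show ?thesis by blast
    qed
    have lb: "?f n \<ge> 1 / real CARD('s)" if "crosses n T" for n
    proof -
      obtain p q where pq: "p \<in> T" "q \<in> -T" "q \<in> D n p"
        using \<open>crosses n T\<close> unfolding crosses_def by blast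
      have "1 / real CARD('s) \<le> ?a n p q" using pq by (intro jlm_chain_ge) (simp add: jlm_chain_eq_0_iff)
      also have "\<dots> \<le> ?a n p q + ?a n q p" by (simp add: jlm_chain_nonneg)
      also have "\<dots> \<le> (\<Sum>j\<in>-T. ?a n p j + ?a n j p)"
        using pq by (intro member_le_sum) (auto simp: jlm_chain_nonneg)
      also have "\<dots> \<le> ?f n"
        using pq by (intro member_le_sum) (auto simp: jlm_chain_nonneg sum_nonneg)
      finally show ?thesis .
    qed
    have "?f n = 0 \<or> ?f n \<ge> 1 / real CARD('s)" for n using nz lb by blast
    then show ?thesis
      by (subst suminf_ennreal_infinite_iff_frequently[of "1 / real CARD('s)"]) (auto simp: nz)
  qed
  then show ?thesis by (simp add: infinite_flow_def recurrent_cuts_def)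
qed

text \<open>Diagonal weights only yield loops, which cross no cut. As there are finitely many pairs,
  a cut crossed infinitely often contains one pair that interacts infinitely often.\<close>

lemma connected_strong_interaction_graph_iff_recurrent_cuts:
  "Digraph_Component.connected (with_proj (strong_interaction_graph (jlm_chain D))) \<longleftrightarrow>
    recurrent_cuts"
proof -
  let ?G = "strong_interaction_graph (jlm_chain D)"
  have "(\<Sum>n. ennreal (jlm_chain D n $ i $ j)) = \<infinity> \<longleftrightarrow>
      (\<exists>\<^sub>F n in sequentially. jlm_chain D n $ i $ j \<noteq> 0)" for i j
    by (rule suminf_ennreal_infinite_iff_frequently[of "1 / real CARD('s)"])
      (use jlm_chain_ge in auto)
  then have arc: "(i, j) \<in> parcs ?G \<longleftrightarrow> (\<exists>\<^sub>F n in sequentially. j = i \<or> j \<in> D n i)" for i j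
    by (simp add: strong_interaction_graph_def jlm_chain_eq_0_iff disj_commute)
  have "(\<exists>p\<in>T. \<exists>q\<in>-T. (p, q) \<in> parcs ?G \<or> (q, p) \<in> parcs ?G) \<longleftrightarrow>
      (\<exists>\<^sub>F n in sequentially. crosses n T)" for T
  proof -
    have "(\<exists>p\<in>T. \<exists>q\<in>-T. (p, q) \<in> parcs ?G \<or> (q, p) \<in> parcs ?G) \<longleftrightarrow>
        (\<exists>p\<in>T. \<exists>q\<in>-T. \<exists>\<^sub>F n in sequentially. q \<in> D n p)"
    proof (intro bex_cong refl)
      fix p q assume "p \<in> T" "q \<in> -T"
      then have "p \<noteq> q" by auto
      then show "(p, q) \<in> parcs ?G \<or> (q, p) \<in> parcs ?G \<longleftrightarrow> (\<exists>\<^sub>F n in sequentially. q \<in> D n p)"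
        using D_sym[of p _ q] by (simp add: arc)
    qed
    then show ?thesis by (simp add: crosses_def frequently_bex_finite_distrib)
  qed
  moreover have "pverts ?G = UNIV" by (simp add: strong_interaction_graph_def)
  ultimately show ?thesis by (simp add: connected_iff_crossing recurrent_cuts_def)
qed

section \<open>Cuts and contiguous linking intervals\<close>

lemma linked_together_iff_crosses:
  "linked_together D a b \<longleftrightarrow>
    (\<forall>T. T \<noteq> {} \<and> T \<noteq> UNIV \<longrightarrow> (\<exists>n\<in>{a..<b}. crosses n T))"
proof -
  have "(\<exists>p\<in>T. \<exists>q\<in>-T. (\<exists>n\<in>{a..<b}. q \<in> D n p) \<or> (\<exists>n\<in>{a..<b}. p \<in> D n q)) \<longleftrightarrow>
      (\<exists>n\<in>{a..<b}. crosses n T)" for T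
    unfolding crosses_def using D_sym by blast
  then show ?thesis
    by (simp add: linked_together_def connected_iff_crossing interaction_graph_def)
qed

lemma linked_intervals_iff_recurrent_cuts:
  "(\<exists>t. strict_mono t \<and> (\<forall>i. linked_together D (t i) (t (Suc i)))) \<longleftrightarrow> recurrent_cuts"
proof
  assume "\<exists>t. strict_mono t \<and> (\<forall>i. linked_together D (t i) (t (Suc i)))"
  then obtain t :: "nat \<Rightarrow> nat" where t: "strict_mono t"
    and linked: "\<And>i. linked_together D (t i) (t (Suc i))" by blast
  show recurrent_cuts
    unfolding recurrent_cuts_def frequently_sequentially
  proof (intro allI impI)
    fix T :: "'s set" and m assume "T \<noteq> {} \<and> T \<noteq> UNIV"
    \<comment> \<open>Since \<open>t m \<ge> m\<close>, a crossing in the interval of index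
      \<open>m\<close> occurs no earlier than \<open>m\<close>.\<close>
    then obtain n where "n \<in> {t m..<t (Suc m)}" "crosses n T"
      using linked[of m] linked_together_iff_crosses by blast
    moreover have "m \<le> t m" using t by (rule strict_mono_imp_increasing)
    ultimately show "\<exists>n\<ge>m. crosses n T" by (intro exI[of _ n]) auto
  qed
next
  assume rec: recurrent_cuts
  have step: "\<exists>b>a. linked_together D a b" for a
  proof -
    \<comment> \<open>Each cut is crossed in \<open>{a..<b}\<close> for all large \<open>b\<close>;
      since there are finitely many cuts, one \<open>b\<close> serves them all.\<close>
    have "\<forall>\<^sub>F b in sequentially. T \<noteq> {} \<and> T \<noteq> UNIV \<longrightarrow> (\<exists>n\<in>{a..<b}. crosses n T)" for T
    proof (cases "T \<noteq> {} \<and> T \<noteq> UNIV")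
      case True
      then obtain n where n: "n \<ge> a" "crosses n T"
        using rec by (auto simp: recurrent_cuts_def frequently_sequentially)
      show ?thesis using eventually_gt_at_top[of n]
        by eventually_elim (use n in auto)
    qed auto
    then have "\<forall>\<^sub>F b in sequentially. linked_together D a b"
      unfolding linked_together_iff_crosses by (intro eventually_all_finite)
    then have "\<forall>\<^sub>F b in sequentially. b > a \<and> linked_together D a b"
      using eventually_gt_at_top by eventually_elim simp
    then show ?thesis using eventually_happens by force
  qed
  obtain t :: "nat \<Rightarrow> nat" where "\<And>i. t i < t (Suc i) \<and> linked_together D (t i) (t (Suc i))"
    using dependent_nat_choice[of "\<lambda>_ _. True" "\<lambda>_ a b. a < b \<and> linked_together D a b"] step
    by auto
  then show "\<exists>t. strict_mono t \<and> (\<forall>i. linked_together D (t i) (t (Suc i)))"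
    using strict_mono_Suc_iff by blast
qed

lemma recurrent_cuts_if_consensus:
  assumes "unconditional_consensus D"
  shows recurrent_cuts
proof (rule ccontr)
  assume "\<not> recurrent_cuts"
  then obtain T p q k where T: "p \<in> T" "q \<notin> T" and k: "\<And>n. n \<ge> k \<Longrightarrow> \<not> crosses n T"
    by (auto simp: recurrent_cuts_def frequently_sequentially)
  let ?\<theta> = "\<lambda>(n::nat) i. if i \<in> T then 1 else 0 :: real"
  have "jlm_evolution D k ?\<theta>"
    unfolding jlm_evolution_iff_average
  proof (intro allI impI)
    fix n i assume "n \<ge> k"
    \<comment> \<open>By symmetry, an uncrossed \<open>T\<close> splits the agents so that each
      closed neighborhood lies on one side; the indicator is constant there and equals its
      mean.\<close>
    then have "\<forall>j\<in>insert i (D n i). j \<in> T \<longleftrightarrow> i \<in> T"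
      using k[of n] D_sym unfolding crosses_def by blast
    then have "(\<Sum>j\<in>insert i (D n i). ?\<theta> n j) = (\<Sum>j\<in>insert i (D n i). ?\<theta> n i)"
      by (intro sum.cong) auto
    then show "?\<theta> (Suc n) i = (\<Sum>j\<in>insert i (D n i). ?\<theta> n j) / real (card (insert i (D n i)))"
      by (simp del: sum.insert card_insert_disjoint add: card_gt_0_iff)
  qed
  then have "\<exists>c. \<forall>i. (\<lambda>n. ?\<theta> n i) \<longlonglongrightarrow> c"
    by (rule unconditional_consensusD[OF assms])
  then obtain c where c: "\<And>i. (\<lambda>n. ?\<theta> n i) \<longlonglongrightarrow> c" by blast
  have "c = 1" using c[of p] T by (simp add: LIMSEQ_const_iff)
  moreover have "c = 0" using c[of q] T by (simp add: LIMSEQ_const_iff)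
  ultimately show False by simp
qed

section \<open>Contraction of the diameter\<close>

text \<open>The bound is assumed only on the closed neighborhood of \<open>i\<close>, so it can be
  applied to the whole agent set and also inside an uncrossed set.\<close>

lemma evolution_ge:
  assumes "jlm_evolution D k \<theta>" "n \<ge> k" and "\<And>j. j \<in> insert i (D n i) \<Longrightarrow> \<theta> n j \<ge> m"
  shows "\<theta> (Suc n) i \<ge> m"
proof -
  let ?P = "insert i (D n i)"
  have "real (card ?P) * m \<le> (\<Sum>j\<in>?P. \<theta> n j)"
    by (intro sum_bounded_below) (use assms(3) in auto)
  moreover have "real (card ?P) > 0" by (simp add: card_gt_0_iff)
  ultimately show ?thesis
    unfolding jlm_evolution_average[OF assms(1,2)] by (simp only: pos_le_divide_eq mult.commute)
qed

text \<open>Reflection turns lower bounds into upper bounds.\<close>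

lemma evolution_uminus:
  assumes "jlm_evolution D k \<theta>"
  shows "jlm_evolution D k (\<lambda>n i. - \<theta> n i)"
  unfolding jlm_evolution_iff_average
proof (intro allI impI)
  fix n i assume "k \<le> n"
  then show "- \<theta> (Suc n) i =
      (\<Sum>j\<in>insert i (D n i). - \<theta> n j) / real (card (insert i (D n i)))"
    by (simp only: jlm_evolution_average[OF assms] sum_negf minus_divide_left)
qed

text \<open>The excesses over \<open>m\<close> are nonnegative, and one of them is at least
  \<open>v\<close>; averaging divides by at most \<open>CARD('s)\<close>. The case
  \<open>l = i\<close> covers an agent keeping a share of its own height.\<close>

lemma evolution_ge_interaction:
  assumes "jlm_evolution D k \<theta>" "n \<ge> k" and ge: "\<And>j. \<theta> n j \<ge> m"
    and l: "l \<in> insert i (D n i)" "\<theta> n l \<ge> m + v" "v \<ge> 0"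
  shows "\<theta> (Suc n) i \<ge> m + v / real CARD('s)"
proof -
  let ?P = "insert i (D n i)"
  have P: "real (card ?P) > 0" by (simp add: card_gt_0_iff)
  have "(\<Sum>j\<in>?P. \<theta> n j - m) = (\<Sum>j\<in>?P. \<theta> n j) - real (card ?P) * m"
    by (simp add: sum_subtractf del: sum.insert card_insert_disjoint)
  moreover have "v \<le> \<theta> n l - m" using l by simp
  moreover have "\<theta> n l - m \<le> (\<Sum>j\<in>?P. \<theta> n j - m)"
    using l ge by (intro member_le_sum) auto
  ultimately have "m * real (card ?P) + v \<le> (\<Sum>j\<in>?P. \<theta> n j)"
    by (simp add: mult.commute del: sum.insert card_insert_disjoint)
  moreover have "(m + v * (1 / real (card ?P))) * real (card ?P) = m * real (card ?P) + v"
    using P by (simp add: distrib_right del: card_insert_disjoint)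
  ultimately have "m + v * (1 / real (card ?P)) \<le> (\<Sum>j\<in>?P. \<theta> n j) / real (card ?P)"
    using P by (simp only: pos_le_divide_eq)
  moreover have "v * (1 / real CARD('s)) \<le> v * (1 / real (card ?P))"
    using \<open>v \<ge> 0\<close> by (rule mult_left_mono[OF inverse_card_le])
  ultimately show ?thesis
    unfolding jlm_evolution_average[OF assms(1,2)] by simp
qed

text \<open>Induction on the number of agents outside \<open>C\<close>: the first crossing strictly
  enlarges \<open>C\<close> at the price of one factor \<open>1 / real CARD('s)\<close>.\<close>

lemma spread_from_set:
  assumes evo: "jlm_evolution D k \<theta>" and rec: recurrent_cuts
    and "n \<ge> k" "\<And>j. \<theta> n j \<ge> m" "v \<ge> 0" "C \<noteq> {}" "\<And>i. i \<in> C \<Longrightarrow> \<theta> n i \<ge> m + v"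
  shows "\<exists>N\<ge>n. \<forall>i. \<theta> N i \<ge> m + v * (1 / real CARD('s)) ^ card (-C)"
  using assms(3-)
proof (induction "card (-C)" arbitrary: n v C rule: less_induct)
  case less
  define \<delta> where "\<delta> = 1 / real CARD('s)"
  have \<delta>: "0 \<le> \<delta>" "\<delta> \<le> 1" by (auto simp: \<delta>_def Suc_le_eq)
  show ?case
  proof (cases "C = UNIV")
    case True
    then show ?thesis using less.prems by (intro exI[of _ n]) auto
  next
    case False
    then have ex: "\<exists>N\<ge>n. crosses N C"
      using rec \<open>C \<noteq> {}\<close> by (auto simp: recurrent_cuts_def frequently_sequentially)
    \<comment> \<open>Taking the first crossing time keeps \<open>C\<close> isolated on all of
      \<open>{n..<N}\<close>.\<close>
    define N where "N = (LEAST N. N \<ge> n \<and> crosses N C)"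
    have N: "N \<ge> n" "crosses N C"
      using LeastI_ex[of "\<lambda>N. N \<ge> n \<and> crosses N C"] ex by (auto simp: N_def)
    have uncrossed: "\<not> crosses l C" if "n \<le> l" "l < N" for l
      using not_less_Least[of l "\<lambda>N. N \<ge> n \<and> crosses N C"] that by (auto simp: N_def)
    have before: "l \<le> N \<longrightarrow> (\<forall>j. \<theta> l j \<ge> m) \<and> (\<forall>i\<in>C. \<theta> l i \<ge> m + v)" if "n \<le> l" for l
      using that
    proof (induction l rule: dec_induct)
      case base
      then show ?case using less.prems by simp
    next
      case (step l)
      show ?case
      proof (intro impI conjI allI ballI)
        fix j assume "Suc l \<le> N"
        then show "\<theta> (Suc l) j \<ge> m"
          using step less.prems(1) by (intro evolution_ge[OF evo]) auto
      next
        fix i assume "Suc l \<le> N" "i \<in> C"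
        then have "insert i (D l i) \<subseteq> C"
          using uncrossed[of l] step unfolding crosses_def by auto
        then show "\<theta> (Suc l) i \<ge> m + v"
          using step less.prems(1) \<open>Suc l \<le> N\<close> by (intro evolution_ge[OF evo]) auto
      qed
    qed
    have ge: "\<theta> N j \<ge> m" for j using before[OF N(1)] by simp
    have "N \<ge> k" using N less.prems(1) by simp
    define C' where "C' = C \<union> (\<Union>i\<in>C. D N i)"
    have "C \<subset> C'" using N(2) by (auto simp: C'_def crosses_def)
    then have less_card: "card (-C') < card (-C)" by (intro psubset_card_mono) auto
    have "\<exists>N'\<ge>Suc N. \<forall>i. \<theta> N' i \<ge> m + (v * \<delta>) * \<delta> ^ card (-C')"
      unfolding \<delta>_def
    proof (rule less.hyps[OF less_card])
      show "Suc N \<ge> k" using \<open>N \<ge> k\<close> by simp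
      show "\<theta> (Suc N) j \<ge> m" for j using ge by (intro evolution_ge[OF evo \<open>N \<ge> k\<close>])
      show "v * (1 / real CARD('s)) \<ge> 0" using \<open>v \<ge> 0\<close> by simp
      show "C' \<noteq> {}" using \<open>C \<subset> C'\<close> by auto
      fix i assume "i \<in> C'"
      \<comment> \<open>Either \<open>i\<close> is in \<open>C\<close> itself, with
        \<open>l = i\<close>, or symmetry gives it a neighbor in \<open>C\<close>.\<close>
      then obtain l where "l \<in> C" "l \<in> insert i (D N i)"
        using D_sym by (auto simp: C'_def)
      then have "\<theta> (Suc N) i \<ge> m + v / real CARD('s)"
        using before[OF N(1)] \<open>v \<ge> 0\<close>
        by (intro evolution_ge_interaction[OF evo \<open>N \<ge> k\<close>]) auto
      then show "\<theta> (Suc N) i \<ge> m + v * (1 / real CARD('s))" by simp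
    qed
    then obtain N' where N': "N' \<ge> Suc N" "\<And>i. \<theta> N' i \<ge> m + v * \<delta> ^ Suc (card (-C'))"
      by (auto simp: mult.assoc)
    \<comment> \<open>Several agents may join at once for a single factor, so the exponent
      \<open>Suc (card (-C'))\<close> can be smaller than \<open>card (-C)\<close>.\<close>
    moreover have "v * \<delta> ^ card (-C) \<le> v * \<delta> ^ Suc (card (-C'))"
      using less_card \<delta> \<open>v \<ge> 0\<close> by (intro mult_left_mono power_decreasing) auto
    ultimately have "N' \<ge> n \<and> (\<forall>i. \<theta> N' i \<ge> m + v * \<delta> ^ card (-C))"
      using N(1) by (meson Suc_leD add_left_mono order_trans)
    then show ?thesis unfolding \<delta>_def by blast
  qed
qed

lemma consensus_if_recurrent_cuts:
  assumes rec: recurrent_cuts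
  shows "unconditional_consensus D"
  unfolding unconditional_consensus_def
proof (intro allI impI)
  fix k \<theta> assume evo: "jlm_evolution D k \<theta>"
  \<comment> \<open>Time is shifted by \<open>k\<close>, so that \<open>hi\<close> and
    \<open>lo\<close> are monotone from index 0 on.\<close>
  define hi where "hi n = Max (range (\<theta> (n + k)))" for n
  define lo where "lo n = Min (range (\<theta> (n + k)))" for n
  \<comment> \<open>The exponent bounds \<open>card (-{i})\<close>, making the rate independent of
    which agent is maximal.\<close>
  define \<epsilon> where "\<epsilon> = (1 / real CARD('s)) ^ CARD('s)"
  have "\<epsilon> > 0" by (simp add: \<epsilon>_def)
  have le_hi: "\<theta> (n + k) i \<le> hi n" and ge_lo: "lo n \<le> \<theta> (n + k) i" for n i
    by (simp_all add: hi_def lo_def)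
  have hi_leI: "hi n \<le> c" if "\<And>i. \<theta> (n + k) i \<le> c" for n c
    using that by (simp add: hi_def)
  have lo_geI: "c \<le> lo n" if "\<And>i. \<theta> (n + k) i \<ge> c" for n c
    using that by (simp add: lo_def)
  have "incseq lo"
  proof (rule incseq_SucI, rule lo_geI)
    show "lo n \<le> \<theta> (Suc n + k) i" for n i
      using ge_lo evolution_ge[OF evo, of "n + k"] by simp
  qed
  have "decseq hi"
  proof (rule decseq_SucI, rule hi_leI)
    fix n i
    show "\<theta> (Suc n + k) i \<le> hi n"
      using le_hi[of n] evolution_ge[OF evolution_uminus[OF evo], of "n + k" i "- hi n"] by simp
  qed
  have "(\<lambda>n. hi n - lo n) \<longlonglongrightarrow> 0"
  proof (rule decseq_contracting_tendsto_zero[OF _ _ \<open>\<epsilon> > 0\<close>])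
    show "decseq (\<lambda>n. hi n - lo n)"
      using \<open>incseq lo\<close> \<open>decseq hi\<close> unfolding decseq_def incseq_def by (meson diff_mono)
    show nonneg: "hi n - lo n \<ge> 0" for n
      using le_hi ge_lo by (metis diff_ge_0_iff_ge order_trans)
    fix n
    \<comment> \<open>A maximal agent \<open>i\<close> has height \<open>hi n - lo n\<close> above
      the minimum, so \<open>{i}\<close> can start the spreading.\<close>
    have "hi n \<in> range (\<theta> (n + k))" unfolding hi_def by (intro Max_in) auto
    then obtain i where i: "\<theta> (n + k) i = hi n" by (metis rangeE)
    obtain N where N: "N \<ge> n + k"
      "\<And>j. \<theta> N j \<ge> lo n + (hi n - lo n) * (1 / real CARD('s)) ^ card (-{i})"
      using spread_from_set[OF evo rec, of "n + k" "lo n" "hi n - lo n" "{i}"] i ge_lo nonneg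
      by auto
    have "(1 / real CARD('s)) ^ card (-{i}) \<ge> \<epsilon>"
      unfolding \<epsilon>_def by (intro power_decreasing) (auto simp: Suc_le_eq card_mono)
    then have "(hi n - lo n) * \<epsilon> \<le> (hi n - lo n) * (1 / real CARD('s)) ^ card (-{i})"
      using nonneg by (rule mult_left_mono)
    then have "\<theta> N j \<ge> lo n + (hi n - lo n) * \<epsilon>" for j
      using N(2)[of j] by linarith
    then have "lo (N - k) \<ge> lo n + (hi n - lo n) * \<epsilon>"
      using N(1) by (intro lo_geI) simp
    \<comment> \<open>The minimum has risen by the fraction \<open>\<epsilon>\<close> of the
      diameter and the maximum has not risen. The index \<open>N - k\<close> undoes the time
      shift.\<close>
    moreover have "hi (N - k) \<le> hi n"
      using \<open>decseq hi\<close> N(1) by (simp add: decseq_def)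
    ultimately show "\<exists>N. hi N - lo N \<le> (1 - \<epsilon>) * (hi n - lo n)"
      by (intro exI[of _ "N - k"]) (simp add: algebra_simps)
  qed
  moreover have "lo 0 \<le> hi n" for n
    using \<open>incseq lo\<close> ge_lo le_hi by (meson incseqD le0 order_trans)
  then obtain c where c: "hi \<longlonglongrightarrow> c"
    using decseq_convergent[OF \<open>decseq hi\<close>] by blast
  ultimately have lo: "lo \<longlonglongrightarrow> c"
    using tendsto_diff[of hi c sequentially "\<lambda>n. hi n - lo n" 0] by simp
  have "(\<lambda>n. \<theta> (n + k) i) \<longlonglongrightarrow> c" for i
    by (rule tendsto_sandwich[OF _ _ lo c]) (simp_all add: le_hi ge_lo)
  then have "(\<lambda>n. \<theta> n i) \<longlonglongrightarrow> c" for i by (rule LIMSEQ_offset)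
  then show "\<exists>c. \<forall>i. (\<lambda>n. \<theta> n i) \<longlonglongrightarrow> c" by iprover
qed

end

theorem mainTheorem6:
  fixes D :: "nat \<Rightarrow> 's::finite \<Rightarrow> 's set"
  assumes "\<And>n i. D n i \<subseteq> UNIV - {i}"
    and "\<And>n i j. j \<in> D n i \<longleftrightarrow> i \<in> D n j"
  shows "(ergodic (jlm_chain D) \<longleftrightarrow> unconditional_consensus D) \<and>
    (ergodic (jlm_chain D) \<longleftrightarrow> infinite_flow (jlm_chain D)) \<and>
    (ergodic (jlm_chain D) \<longleftrightarrow>
       Digraph_Component.connected (strong_interaction_graph (jlm_chain D))) \<and>
    (ergodic (jlm_chain D) \<longleftrightarrow>
       (\<exists>t :: nat \<Rightarrow> nat. strict_mono t \<and> (\<forall>i. linked_together D (t i) (t (Suc i)))))"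
proof -
  interpret jlm D by unfold_locales (use assms in auto)
  \<comment> \<open>The remaining conditions have each been reduced to
    \<open>recurrent_cuts\<close>, so this equivalence connects them all.\<close>
  have "unconditional_consensus D \<longleftrightarrow> recurrent_cuts"
    using recurrent_cuts_if_consensus consensus_if_recurrent_cuts by iprover
  then show ?thesis
    by (simp only: ergodic_iff_unconditional_consensus infinite_flow_iff_recurrent_cuts
        connected_strong_interaction_graph_iff_recurrent_cuts linked_intervals_iff_recurrent_cuts)
qed

end
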